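(* Let $R$ be a commutative semiring and let $S\subseteq R$ be a multiplicatively closed subset. If $I$ is an $S$-prime ideal of $R$ and $I=N(R)$, then $I$ is a quasi $S$-$n$-ideal of $R$.
   Context: All semirings are commutative with identity $1\neq 0$. A subset $S$ of $R$ is multiplicatively closed if $0\notin S$, $1\in S$, and $st\in S$ for all $s,t\in S$. $N(R)$ denotes the nilradical (set of nilpotent elements) of $R$. An ideal $I$ of $R$ with $I\cap S=\emptyset$ is $S$-prime if there exists $s\in S$ such that, for all $a,b\in R$, $ab\in I$ implies $sa\in I$ or $sb\in I$. A proper ideal $I$ of $R$ with $I\cap S=\emptyset$ is a quasi $S$-$n$-ideal of $R$ if there exists a fixed element $s\in S$ such that, for all $a,b\in R$, $ab\in I$ implies $sa^2\in I$ or $sb\in N(R)$. *)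

theory Defs
  imports Main
begin

text \<open>
  The commutative semiring \<open>R\<close> with identity \<open>1 \<noteq> 0\<close> is the whole of a type of class
  \<^class>\<open>comm_semiring_1\<close>, in which \<open>0 \<noteq> 1\<close> and \<open>0\<close> is absorbing; additive inverses are not
  assumed.
\<close>

definition multiplicatively_closed :: "'a::comm_semiring_1 set \<Rightarrow> bool" where
  "multiplicatively_closed S \<longleftrightarrow> 0 \<notin> S \<and> 1 \<in> S \<and> (\<forall>s\<in>S. \<forall>t\<in>S. s * t \<in> S)"

text \<open>Nonemptiness together with closure under multiplication by \<open>0\<close> gives \<open>0 \<in> I\<close>.\<close>

definition semiring_ideal :: "'a::comm_semiring_1 set \<Rightarrow> bool" where
  "semiring_ideal I \<longleftrightarrow>
     I \<noteq> {} \<and> (\<forall>a\<in>I. \<forall>b\<in>I. a + b \<in> I) \<and> (\<forall>r. \<forall>a\<in>I. r * a \<in> I)"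

definition nilradical :: "'a::comm_semiring_1 set" where
  "nilradical = {a. \<exists>n::nat. n \<ge> 1 \<and> a ^ n = 0}"

definition S_prime_ideal :: "'a::comm_semiring_1 set \<Rightarrow> 'a set \<Rightarrow> bool" where
  "S_prime_ideal S I \<longleftrightarrow>
     semiring_ideal I \<and> I \<inter> S = {} \<and>
     (\<exists>s\<in>S. \<forall>a b. a * b \<in> I \<longrightarrow> s * a \<in> I \<or> s * b \<in> I)"

definition quasi_S_n_ideal :: "'a::comm_semiring_1 set \<Rightarrow> 'a set \<Rightarrow> bool" where
  "quasi_S_n_ideal S I \<longleftrightarrow>
     semiring_ideal I \<and> I \<noteq> UNIV \<and> I \<inter> S = {} \<and>
     (\<exists>s\<in>S. \<forall>a b. a * b \<in> I \<longrightarrow> s * a ^ 2 \<in> I \<or> s * b \<in> nilradical)"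

end

theory Submission
  imports Defs
begin

text \<open>
  An element \<open>s\<close> witnessing that \<open>I\<close> is \<open>S\<close>-prime also witnesses the quasi
  \<open>S\<close>-\<open>n\<close>-property: \<open>s * a \<in> I\<close> gives \<open>s * a ^ 2 \<in> I\<close> on multiplying by \<open>a\<close>, and
  \<open>s * b \<in> I\<close> already says \<open>s * b \<in> nilradical\<close>. The ideal is proper because it avoids \<open>1 \<in> S\<close>.
\<close>

theorem theorem2p8:
  fixes S I :: "'a::comm_semiring_1 set"
  assumes "multiplicatively_closed S"
    and "S_prime_ideal S I"
    and "I = nilradical"
  shows "quasi_S_n_ideal S I"
proof -
  have ideal: "semiring_ideal I" and disjoint: "I \<inter> S = {}"
    using assms(2) unfolding S_prime_ideal_def by auto
  have "1 \<in> S"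
    using assms(1) unfolding multiplicatively_closed_def by blast
  then have proper: "I \<noteq> UNIV"
    using disjoint by blast
  obtain s where s: "s \<in> S" and prime: "\<And>a b. a * b \<in> I \<Longrightarrow> s * a \<in> I \<or> s * b \<in> I"
    using assms(2) unfolding S_prime_ideal_def by blast
  have "s * a ^ 2 \<in> I \<or> s * b \<in> nilradical" if "a * b \<in> I" for a b
    using prime[OF that]
  proof
    assume "s * a \<in> I"
    then have "a * (s * a) \<in> I"
      using ideal unfolding semiring_ideal_def by blast
    then show ?thesis
      by (simp add: power2_eq_square mult.left_commute)
  next
    assume "s * b \<in> I"
    then show ?thesis
      using assms(3) by simp
  qed
  with ideal proper disjoint s show ?thesis
    unfolding quasi_S_n_ideal_def by blast
qed

end
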